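(* Let $\Gamma$ be a non-complete edge-regular graph with parameters $(v,k,\lambda)$, and let $\overline{\Gamma}$ be its complement, which is $(v-k-1)$-regular with smallest eigenvalue $\overline{\sigma}$. Then $$\mathrm{CAB}(\Gamma)\le \mathrm{Haem}_{\geq}(\overline{\Gamma},0)=v\,\frac{-\overline{\sigma}}{(v-k-1)-\overline{\sigma}}.$$
   Context: A graph is edge-regular with parameters $(v,k,\lambda)$ if it has $v$ vertices, is $k$-regular, has at least one edge, and any two adjacent vertices have exactly $\lambda$ common neighbours. Its clique adjacency polynomial is $C_\Gamma(x,y)=(v-y)x(x+1)-2xy(k-y+1)+y(y-1)(\lambda-y+2)$, and the clique adjacency bound $\mathrm{CAB}(\Gamma)$ is the least integer $y\ge2$ such that $C_\Gamma(m,y+1)<0$ for some integer $m$. For a $k'$-regular graph $\Delta$ of order $v$ with smallest adjacency eigenvalue $\sigma'$, $\mathrm{Haem}_{\geq}(\Delta,d)=v\frac{d-\sigma'}{k'-\sigma'}$. *)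

theory Defs
  imports
    "Graph_Theory.Graph_Theory"
    "Jordan_Normal_Form.Spectral_Radius"
    "HOL-Library.Countable_Set"
begin

text \<open>
  Finite simple graphs are the \<open>pair_graph\<close>s of the Graph Theory library: finite vertex set,
  no loops, and every edge present as both of its arcs. Hence the degree of a vertex is its
  out-degree.
\<close>

definition regular_graph :: "'a pair_pre_digraph \<Rightarrow> nat \<Rightarrow> bool" where
  "regular_graph G k \<longleftrightarrow> pair_graph G \<and> (\<forall>u\<in>pverts G. out_degree G u = k)"

definition edge_regular :: "'a pair_pre_digraph \<Rightarrow> nat \<Rightarrow> nat \<Rightarrow> nat \<Rightarrow> bool" where
  "edge_regular G v k l \<longleftrightarrow>
     regular_graph G k \<and> card (pverts G) = v \<and> parcs G \<noteq> {} \<and>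
     (\<forall>x y. x \<rightarrow>\<^bsub>G\<^esub> y \<longrightarrow> card {w \<in> pverts G. x \<rightarrow>\<^bsub>G\<^esub> w \<and> y \<rightarrow>\<^bsub>G\<^esub> w} = l)"

definition complement_graph :: "'a pair_pre_digraph \<Rightarrow> 'a pair_pre_digraph" where
  "complement_graph G =
     \<lparr> pverts = pverts G,
       parcs = {(x, y). x \<in> pverts G \<and> y \<in> pverts G \<and> x \<noteq> y \<and> \<not> x \<rightarrow>\<^bsub>G\<^esub> y} \<rparr>"

lemma pair_graph_complement:
  assumes "pair_graph G"
  shows "pair_graph (complement_graph G)"
proof -
  interpret pair_graph G by fact
  have "parcs (complement_graph G) \<subseteq> pverts G \<times> pverts G"
    by (auto simp: complement_graph_def)
  then have "finite (parcs (complement_graph G))"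
    using pair_finite_verts by (meson finite_SigmaI finite_subset)
  then show ?thesis
    using pair_finite_verts
    by unfold_locales
       (auto simp: complement_graph_def symmetric_def sym_def dest: arcs_symmetric)
qed

text \<open>
  The rows and columns are indexed by the enumeration \<^const>\<open>from_nat_into\<close> of the vertex set.
  Another enumeration conjugates the matrix by a permutation matrix, so the spectrum does not
  depend on this choice.
\<close>

definition adjacency_matrix :: "'a pair_pre_digraph \<Rightarrow> real mat" where
  "adjacency_matrix G =
     mat (card (pverts G)) (card (pverts G))
       (\<lambda>(i, j). if from_nat_into (pverts G) i \<rightarrow>\<^bsub>G\<^esub> from_nat_into (pverts G) j then 1 else 0)"

text \<open>
  The adjacency matrix of a \<open>pair_graph\<close> is symmetric, so all its eigenvalues are real and no
  eigenvalue is lost by taking the spectrum over the reals.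
\<close>

definition smallest_eigenvalue :: "'a pair_pre_digraph \<Rightarrow> real" where
  "smallest_eigenvalue G = Min (spectrum (adjacency_matrix G))"

lemma finite_spectrum_adjacency_matrix: "finite (spectrum (adjacency_matrix G))"
  by (rule card_finite_spectrum(1)[of _ "card (pverts G)"]) (simp add: adjacency_matrix_def)

definition clique_adjacency_poly :: "nat \<Rightarrow> nat \<Rightarrow> nat \<Rightarrow> real \<Rightarrow> real \<Rightarrow> real" where
  "clique_adjacency_poly v k l x y =
     (real v - y) * x * (x + 1) - 2 * x * y * (real k - y + 1) + y * (y - 1) * (real l - y + 2)"

text \<open>
  The clique adjacency bound of an edge-regular graph, as a function of its parameters.
\<close>

definition CAB :: "nat \<Rightarrow> nat \<Rightarrow> nat \<Rightarrow> nat" where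
  "CAB v k l =
     (LEAST y::nat. 2 \<le> y \<and> (\<exists>m::int. clique_adjacency_poly v k l (of_int m) (real y + 1) < 0))"

lemma CAB_exists:
  "\<exists>y::nat. 2 \<le> y \<and> (\<exists>m::int. clique_adjacency_poly v k l (of_int m) (real y + 1) < 0)"
proof (intro exI conjI)
  show "clique_adjacency_poly v k l (of_int 0) (real (l + 2) + 1) < 0"
    by (simp add: clique_adjacency_poly_def mult_pos_neg)
qed simp

definition valency :: "'a pair_pre_digraph \<Rightarrow> nat" where
  "valency G = (THE k. regular_graph G k)"

definition Haem_ge :: "'a pair_pre_digraph \<Rightarrow> real \<Rightarrow> real" where
  "Haem_ge G d =
     real (card (pverts G)) * ((d - smallest_eigenvalue G) / (real (valency G) - smallest_eigenvalue G))"

end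

theory Submission
  imports Defs
begin

text \<open>
  Put \<open>\<theta> = - 1 - \<sigma>\<close> with \<open>\<sigma>\<close> the smallest eigenvalue of the complement. On vectors orthogonal to the
  constants, \<open>\<theta>\<close> bounds the Rayleigh quotient of the adjacency matrix \<open>A\<close> of \<open>\<Gamma>\<close>, and the Haemers
  bound is \<open>h = v (1 + \<theta>) / (v - k + \<theta>)\<close>. Let \<open>y = \<lfloor>h\<rfloor> + 1 \<le> v\<close>; if \<open>y = v\<close>,
  then \<open>C(x, y)\<close> is linear in \<open>x\<close>, so assume \<open>y < v\<close>. Testing the Rayleigh bound on the
  projection of \<open>(A - t I) e\<^sub>p\<close>, for a vertex \<open>p\<close> and \<open>t = - k / (y - 1)\<close>, turns \<open>y > h\<close> into the
  statement that the roots of \<open>C(x, y)\<close> in \<open>x\<close> are more than 1 apart, so \<open>C(m, y) < 0\<close> for an integer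
  \<open>m\<close> between them. The test vector \<open>e\<^sub>a + e\<^sub>b\<close> for an edge gives \<open>h \<ge> 2\<close>, and \<open>e\<^sub>c - e\<^sub>d\<close> for a
  non-edge gives \<open>\<theta> \<ge> 0\<close>.
\<close>

subsection \<open>The Rayleigh quotient of a symmetric matrix\<close>

text \<open>For \<open>a > 0\<close> the inequality is nonnegativity at the minimiser
  \<open>- b / a\<close>. The case \<open>a < 0\<close> is impossible, and \<open>a = 0\<close>
  forces \<open>b = 0\<close>.\<close>

lemma discriminant_le_of_nonneg:
  fixes a b c :: real
  assumes nn: "\<And>s. 0 \<le> a * s^2 + 2 * b * s + c"
  shows "b^2 \<le> a * c"
proof (cases "a = 0")
  case True
  have "b = 0"
  proof (rule ccontr)
    assume "b \<noteq> 0"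
    \<comment> \<open>At this point the linear function takes the value -1.\<close>
    then show False using nn[of "- (c + 1) / (2 * b)"] True by simp
  qed
  then show ?thesis using True by simp
next
  case False
  have "a \<ge> 0"
  proof (rule ccontr)
    assume neg: "\<not> a \<ge> 0"
    \<comment> \<open>Chosen so that \<open>a * s = a - (\<bar>2 * b\<bar> + \<bar>c\<bar>)\<close>;
      together with \<open>s \<ge> 1\<close> this pushes the value of the quadratic down to at most
      \<open>a < 0\<close>.\<close>
    define s where "s = 1 + (\<bar>2 * b\<bar> + \<bar>c\<bar>) / (- a)"
    have "(\<bar>2 * b\<bar> + \<bar>c\<bar>) / (- a) \<ge> 0" using neg by (intro divide_nonneg_pos) auto
    then have s1: "s \<ge> 1" by (simp add: s_def)
    have "a * s = a - (\<bar>2 * b\<bar> + \<bar>c\<bar>)" using neg by (simp add: s_def field_simps)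
    moreover have "a * s^2 + 2 * b * s + c = s * (a * s + 2 * b) + c"
      by (simp add: power2_eq_square algebra_simps)
    ultimately have "a * s^2 + 2 * b * s + c = s * (a - \<bar>2 * b\<bar> - \<bar>c\<bar> + 2 * b) + c"
      by simp
    moreover have "s * (a - \<bar>2 * b\<bar> - \<bar>c\<bar> + 2 * b) \<le> 1 * (a - \<bar>2 * b\<bar> - \<bar>c\<bar> + 2 * b)"
      using s1 neg by (intro mult_right_mono_neg) auto
    ultimately show False
      using nn[of s] neg abs_ge_self[of "2 * b"] abs_ge_self[of c] by simp
  qed
  then have a: "a > 0" using False by simp
  have "0 \<le> a * (a * (- b / a)^2 + 2 * b * (- b / a) + c)"
    using nn[of "- b / a"] a by (intro mult_nonneg_nonneg) auto
  also have "\<dots> = a * c - b^2"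
    using a by (simp add: field_simps power2_eq_square)
  finally show ?thesis by simp
qed

lemma scalar_prod_self_nonneg:
  fixes x :: "real vec"
  shows "0 \<le> x \<bullet> x"
  by (simp add: scalar_prod_def sum_nonneg)

text \<open>The form at \<open>s \<cdot>\<^sub>v x + z\<close> is a quadratic in \<open>s\<close>
  that never becomes negative, so its discriminant is not positive.\<close>

lemma psd_cauchy_schwarz:
  fixes M :: "real mat"
  assumes M: "M \<in> carrier_mat n n" and sym: "transpose_mat M = M"
    and psd: "\<And>z. z \<in> carrier_vec n \<Longrightarrow> 0 \<le> z \<bullet> (M *\<^sub>v z)"
    and x: "x \<in> carrier_vec n" and z: "z \<in> carrier_vec n"
  shows "(x \<bullet> (M *\<^sub>v z))^2 \<le> (x \<bullet> (M *\<^sub>v x)) * (z \<bullet> (M *\<^sub>v z))"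
proof -
  have swap: "z \<bullet> (M *\<^sub>v x) = x \<bullet> (M *\<^sub>v z)"
    using transpose_vec_mult_scalar[OF M x z] sym comm_scalar_prod[of "M *\<^sub>v z" n x] M x z
    by (simp add: mult_mat_vec_carrier[OF M])
  have "0 \<le> (x \<bullet> (M *\<^sub>v x)) * s^2 + 2 * (x \<bullet> (M *\<^sub>v z)) * s + z \<bullet> (M *\<^sub>v z)" for s
  proof -
    have Mx: "M *\<^sub>v x \<in> carrier_vec n" and Mz: "M *\<^sub>v z \<in> carrier_vec n" 
      using M x z by auto
    have sx: "s \<cdot>\<^sub>v x \<in> carrier_vec n" "s \<cdot>\<^sub>v (M *\<^sub>v x) \<in> carrier_vec n" using x Mx by auto
    have "M *\<^sub>v (s \<cdot>\<^sub>v x + z) = s \<cdot>\<^sub>v (M *\<^sub>v x) + M *\<^sub>v z"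
      using mult_add_distrib_mat_vec[OF M sx(1) z] mult_mat_vec[OF M x] by simp
    then have "(s \<cdot>\<^sub>v x + z) \<bullet> (M *\<^sub>v (s \<cdot>\<^sub>v x + z))
      = (x \<bullet> (M *\<^sub>v x)) * s^2 + 2 * (x \<bullet> (M *\<^sub>v z)) * s + z \<bullet> (M *\<^sub>v z)"
      using x z Mx Mz sx swap
      by (simp add: add_scalar_prod_distrib[of _ n] scalar_prod_add_distrib[of _ n]
          algebra_simps power2_eq_square)
    then show ?thesis using psd[of "s \<cdot>\<^sub>v x + z"] x z by simp
  qed
  then show ?thesis by (rule discriminant_le_of_nonneg)
qed

lemma scalar_prod_cauchy_schwarz:
  fixes x y :: "real vec"
  assumes "x \<in> carrier_vec n" "y \<in> carrier_vec n"
  shows "(x \<bullet> y)^2 \<le> (x \<bullet> x) * (y \<bullet> y)"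
  using psd_cauchy_schwarz[of "1\<^sub>m n" n x y] assms by (simp add: scalar_prod_self_nonneg)

lemma mult_mat_vec_bounded:
  fixes M :: "real mat"
  assumes M: "M \<in> carrier_mat n n"
  obtains K where "K > 0"
    "\<And>w. w \<in> carrier_vec n \<Longrightarrow> (M *\<^sub>v w) \<bullet> (M *\<^sub>v w) \<le> K * (w \<bullet> w)"
proof
  \<comment> \<open>This is the squared Frobenius norm of \<open>M\<close>. It can vanish, so 1 is
    added to obtain a positive constant.\<close>
  let ?K = "\<Sum>i<n. row M i \<bullet> row M i"
  show "1 + ?K > 0" by (simp add: add_pos_nonneg sum_nonneg scalar_prod_self_nonneg)
  fix w :: "real vec" assume w: "w \<in> carrier_vec n"
  have "(M *\<^sub>v w) \<bullet> (M *\<^sub>v w) = (\<Sum>i<n. (row M i \<bullet> w)^2)"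
    using M by (simp add: scalar_prod_def[of "M *\<^sub>v w"] power2_eq_square lessThan_atLeast0)
  also have "\<dots> \<le> (\<Sum>i<n. (row M i \<bullet> row M i) * (w \<bullet> w))"
    using M w by (intro sum_mono scalar_prod_cauchy_schwarz) auto
  also have "\<dots> = ?K * (w \<bullet> w)" by (simp add: sum_distrib_right)
  also have "\<dots> \<le> (1 + ?K) * (w \<bullet> w)"
    by (intro mult_right_mono) (simp_all add: scalar_prod_self_nonneg)
  finally show "(M *\<^sub>v w) \<bullet> (M *\<^sub>v w) \<le> (1 + ?K) * (w \<bullet> w)" .
qed

lemma quadratic_form_bounded:
  fixes M :: "real mat"
  assumes M: "M \<in> carrier_mat n n"
  obtains C where "C > 0"
    "\<And>w. w \<in> carrier_vec n \<Longrightarrow> \<bar>w \<bullet> (M *\<^sub>v w)\<bar> \<le> C * (w \<bullet> w)"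
proof -
  obtain K where K: "K > 0"
    "\<And>w. w \<in> carrier_vec n \<Longrightarrow> (M *\<^sub>v w) \<bullet> (M *\<^sub>v w) \<le> K * (w \<bullet> w)"
    using mult_mat_vec_bounded[OF M] by blast
  have "\<bar>w \<bullet> (M *\<^sub>v w)\<bar> \<le> sqrt K * (w \<bullet> w)" if w: "w \<in> carrier_vec n" for w
  proof (rule power2_le_imp_le)
    have "\<bar>w \<bullet> (M *\<^sub>v w)\<bar>^2 \<le> (w \<bullet> w) * ((M *\<^sub>v w) \<bullet> (M *\<^sub>v w))"
      unfolding power2_abs using w M by (intro scalar_prod_cauchy_schwarz) auto
    also have "\<dots> \<le> (w \<bullet> w) * (K * (w \<bullet> w))"
      using K(2)[OF w] by (intro mult_left_mono scalar_prod_self_nonneg)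
    also have "\<dots> = (sqrt K * (w \<bullet> w))^2"
      using K(1) by (simp add: power2_eq_square)
    finally show "\<bar>w \<bullet> (M *\<^sub>v w)\<bar>^2 \<le> (sqrt K * (w \<bullet> w))^2" .
    show "0 \<le> sqrt K * (w \<bullet> w)"
      using K(1) by (simp add: scalar_prod_self_nonneg)
  qed
  then show ?thesis using that[of "sqrt K"] K(1) by simp
qed

text \<open>With \<open>w = M *\<^sub>v z\<close>, Cauchy-Schwarz for the form of \<open>M\<close>
  at \<open>w\<close> and \<open>z\<close> bounds the square norm of \<open>w\<close> by
  \<open>C\<close> times the form at \<open>z\<close>. The inverse of \<open>M\<close> bounds the
  square norm of \<open>z\<close> by \<open>K\<close> times that of \<open>w\<close>. This yields
  the constant \<open>1 / (K * C)\<close> without diagonalising \<open>M\<close>.\<close>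

lemma psd_nonsingular_imp_coercive:
  fixes M :: "real mat"
  assumes M: "M \<in> carrier_mat n n" and sym: "transpose_mat M = M"
    and psd: "\<And>z. z \<in> carrier_vec n \<Longrightarrow> 0 \<le> z \<bullet> (M *\<^sub>v z)"
    and det: "det M \<noteq> 0"
  obtains \<epsilon> where "\<epsilon> > 0"
    "\<And>z. z \<in> carrier_vec n \<Longrightarrow> \<epsilon> * (z \<bullet> z) \<le> z \<bullet> (M *\<^sub>v z)"
proof -
  obtain N where N: "N \<in> carrier_mat n n" and NM: "N * M = 1\<^sub>m n"
    using det_non_zero_imp_unit[OF M det, of "()"]
    by (auto simp: Units_def ring_mat_def)
  obtain K where K: "K > 0"
    "\<And>w. w \<in> carrier_vec n \<Longrightarrow> (N *\<^sub>v w) \<bullet> (N *\<^sub>v w) \<le> K * (w \<bullet> w)"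
    using mult_mat_vec_bounded[OF N] by blast
  obtain C where C: "C > 0"
    "\<And>w. w \<in> carrier_vec n \<Longrightarrow> \<bar>w \<bullet> (M *\<^sub>v w)\<bar> \<le> C * (w \<bullet> w)"
    using quadratic_form_bounded[OF M] by blast
  have "1 / (K * C) * (z \<bullet> z) \<le> z \<bullet> (M *\<^sub>v z)" if z: "z \<in> carrier_vec n" for z
  proof -
    define w where "w = M *\<^sub>v z"
    have w: "w \<in> carrier_vec n" using M z by (simp add: w_def)
    have z_eq: "z = N *\<^sub>v w"
      unfolding w_def using assoc_mult_mat_vec[OF N M z] NM z by simp
    have "(w \<bullet> w)^2 \<le> (w \<bullet> (M *\<^sub>v w)) * (z \<bullet> w)"
      using psd_cauchy_schwarz[OF M sym psd w z] by (simp add: w_def)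
    also have "\<dots> \<le> (C * (w \<bullet> w)) * (z \<bullet> w)"
      using C(2)[OF w] psd[OF z] by (intro mult_right_mono) (auto simp: w_def)
    finally have "(w \<bullet> w) * (w \<bullet> w) \<le> (w \<bullet> w) * (C * (z \<bullet> w))"
      by (simp add: power2_eq_square algebra_simps)
    then have "w \<bullet> w \<le> C * (z \<bullet> w)"
      using scalar_prod_self_nonneg[of w] C(1) psd[OF z]
      by (cases "w \<bullet> w = 0") (auto simp: w_def)
    then have "K * (w \<bullet> w) \<le> K * (C * (z \<bullet> w))"
      using K(1) by (intro mult_left_mono) auto
    moreover have "z \<bullet> z \<le> K * (w \<bullet> w)" using K(2)[OF w] z_eq by simp
    ultimately have "z \<bullet> z \<le> (K * C) * (z \<bullet> w)" by simp
    then show ?thesis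
      using K(1) C(1) by (simp add: w_def pos_divide_le_eq mult.commute)
  qed
  then show ?thesis using that[of "1 / (K * C)"] K(1) C(1) by simp
qed

lemma char_matrix_quadratic_form:
  fixes A :: "real mat"
  assumes A: "A \<in> carrier_mat n n" and z: "z \<in> carrier_vec n"
  shows "z \<bullet> (char_matrix A \<mu> *\<^sub>v z) = z \<bullet> (A *\<^sub>v z) - \<mu> * (z \<bullet> z)"
proof -
  have "char_matrix A \<mu> *\<^sub>v z = A *\<^sub>v z + (- \<mu>) \<cdot>\<^sub>v z"
    unfolding char_matrix_def
    by (rule eq_vecI, insert z A, auto simp: add_scalar_prod_distrib[of _ n])
  then show ?thesis
    using A z by (simp add: scalar_prod_add_distrib[of _ n])
qed

text \<open>The minimum is the supremum \<open>\<mu>\<close> of the lower bounds of the Rayleigh quotient: if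
  \<open>A - \<mu> I\<close> were nonsingular, it would be coercive, and \<open>\<mu>\<close> could be increased.\<close>

lemma symmetric_mat_rayleigh:
  fixes A :: "real mat"
  assumes A: "A \<in> carrier_mat n n" and n: "n > 0" and sym: "transpose_mat A = A"
  obtains \<mu> where "eigenvalue A \<mu>"
    "\<And>z. z \<in> carrier_vec n \<Longrightarrow> \<mu> * (z \<bullet> z) \<le> z \<bullet> (A *\<^sub>v z)"
proof -
  define S where "S = {\<mu>. \<forall>z\<in>carrier_vec n. \<mu> * (z \<bullet> z) \<le> z \<bullet> (A *\<^sub>v z)}"
  obtain C where C: "C > 0"
    "\<And>w. w \<in> carrier_vec n \<Longrightarrow> \<bar>w \<bullet> (A *\<^sub>v w)\<bar> \<le> C * (w \<bullet> w)"
    using quadratic_form_bounded[OF A] by blast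
  have "- C \<in> S" unfolding S_def using C(2) by (auto simp: abs_le_iff minus_le_iff)
  then have ne: "S \<noteq> {}" by blast
  \<comment> \<open>Testing at one unit vector bounds \<open>S\<close> above by a diagonal entry;
    \<open>n > 0\<close> provides that vector.\<close>
  have "\<mu> \<le> unit_vec n 0 \<bullet> (A *\<^sub>v unit_vec n 0)" if "\<mu> \<in> S" for \<mu>
  proof -
    have "unit_vec n 0 \<bullet> (unit_vec n 0 :: real vec) = 1" using n by simp
    then show ?thesis using that unfolding S_def
      by (auto dest!: bspec[of _ _ "unit_vec n 0"])
  qed
  then have bdd: "bdd_above S" by (auto simp: bdd_above_def)
  define \<mu> where "\<mu> = Sup S"
  have low: "\<mu> * (z \<bullet> z) \<le> z \<bullet> (A *\<^sub>v z)" if z: "z \<in> carrier_vec n" for z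
  proof (cases "z \<bullet> z = 0")
    case True
    then show ?thesis using C(2)[OF z] by simp
  next
    case False
    then have pos: "z \<bullet> z > 0" using scalar_prod_self_nonneg[of z] by simp
    have "\<mu> \<le> (z \<bullet> (A *\<^sub>v z)) / (z \<bullet> z)"
      unfolding \<mu>_def using z pos by (intro cSup_least[OF ne]) (auto simp: S_def pos_le_divide_eq)
    then show ?thesis using pos by (simp add: pos_le_divide_eq)
  qed
  have "eigenvalue A \<mu>"
  proof (rule ccontr)
    assume "\<not> eigenvalue A \<mu>"
    then have det: "det (char_matrix A \<mu>) \<noteq> 0" using eigenvalue_det[OF A] by simp
    have cA: "char_matrix A \<mu> \<in> carrier_mat n n" using A by simp
    have sym': "transpose_mat (char_matrix A \<mu>) = char_matrix A \<mu>"
    proof (rule eq_matI)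
      fix i j assume "i < dim_row (char_matrix A \<mu>)" "j < dim_col (char_matrix A \<mu>)"
      then have ij: "i < n" "j < n" using cA by auto
      then have "A $$ (j, i) = A $$ (i, j)"
        using arg_cong[OF sym, of "\<lambda>B. B $$ (i, j)"] A by simp
      then show "transpose_mat (char_matrix A \<mu>) $$ (i, j) = char_matrix A \<mu> $$ (i, j)"
        using ij A by (simp add: char_matrix_def)
    qed (use cA in auto)
    have "0 \<le> z \<bullet> (char_matrix A \<mu> *\<^sub>v z)" if "z \<in> carrier_vec n" for z
      using low[OF that] char_matrix_quadratic_form[OF A that] by simp
    then obtain \<epsilon> where \<epsilon>: "\<epsilon> > 0"
      "\<And>z. z \<in> carrier_vec n \<Longrightarrow> \<epsilon> * (z \<bullet> z) \<le> z \<bullet> (char_matrix A \<mu> *\<^sub>v z)"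
      using psd_nonsingular_imp_coercive[OF cA sym' _ det] by blast
    have "\<mu> + \<epsilon> \<in> S"
      unfolding S_def using \<epsilon>(2) char_matrix_quadratic_form[OF A, of _ \<mu>]
      by (fastforce simp: algebra_simps)
    then have "\<mu> + \<epsilon> \<le> \<mu>" unfolding \<mu>_def using bdd by (rule cSup_upper)
    then show False using \<epsilon>(1) by simp
  qed
  then show ?thesis using low that by blast
qed

subsection \<open>Quadratic forms of regular graphs\<close>

text \<open>Some eigenvalue bounds the Rayleigh quotient from below, and the smallest one is at most
  that eigenvalue. Writing the forms as sums over vertices hides the enumeration that indexes the
  matrix.\<close>

lemma smallest_eigenvalue_rayleigh:
  fixes f :: "'a \<Rightarrow> real"
  assumes G: "pair_graph G" and ne: "pverts G \<noteq> {}"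
  shows "smallest_eigenvalue G * (\<Sum>x\<in>pverts G. (f x)^2)
    \<le> (\<Sum>x\<in>pverts G. f x * (\<Sum>y\<in>pverts G. of_bool (x \<rightarrow>\<^bsub>G\<^esub> y) * f y))"
proof -
  interpret pair_graph G by fact
  define n where "n = card (pverts G)"
  define e where "e = from_nat_into (pverts G)"
  define A where "A = adjacency_matrix G"
  have A: "A \<in> carrier_mat n n" by (simp add: A_def adjacency_matrix_def n_def)
  have n: "n > 0" using ne by (simp add: n_def card_gt_0_iff)
  have bij: "bij_betw e {..<n} (pverts G)"
    unfolding e_def n_def by (rule bij_betw_from_nat_into_finite) simp
  have A_ij: "A $$ (i, j) = of_bool (e i \<rightarrow>\<^bsub>G\<^esub> e j)" if "i < n" "j < n" for i j
    using that by (simp add: A_def adjacency_matrix_def n_def e_def)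
  have "transpose_mat A = A"
  proof (rule eq_matI)
    fix i j assume "i < dim_row A" "j < dim_col A"
    then show "transpose_mat A $$ (i, j) = A $$ (i, j)"
      using A by (auto simp: A_ij intro: arcs_symmetric)
  qed (use A in auto)
  then obtain \<mu> where \<mu>: "eigenvalue A \<mu>"
    "\<And>z. z \<in> carrier_vec n \<Longrightarrow> \<mu> * (z \<bullet> z) \<le> z \<bullet> (A *\<^sub>v z)"
    using symmetric_mat_rayleigh[OF A n] by blast
  have le: "smallest_eigenvalue G \<le> \<mu>"
    unfolding smallest_eigenvalue_def
    using finite_spectrum_adjacency_matrix \<mu>(1) by (intro Min_le) (auto simp: spectrum_def A_def)
  define z where "z = vec n (\<lambda>i. f (e i))"
  have z: "z \<in> carrier_vec n" by (simp add: z_def)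
  have zz: "z \<bullet> z = (\<Sum>x\<in>pverts G. (f x)^2)"
    using sum.reindex_bij_betw[OF bij, of "\<lambda>x. (f x)^2"]
    by (simp add: z_def scalar_prod_def power2_eq_square lessThan_atLeast0)
  have Az: "(A *\<^sub>v z) $ i = (\<Sum>y\<in>pverts G. of_bool (e i \<rightarrow>\<^bsub>G\<^esub> y) * f y)" if i: "i < n" for i
  proof -
    have Az: "(A *\<^sub>v z) $ i = (\<Sum>j<n. of_bool (e i \<rightarrow>\<^bsub>G\<^esub> e j) * f (e j))"
      using A i A_ij by (simp add: z_def scalar_prod_def lessThan_atLeast0)
    also have "\<dots> = (\<Sum>y\<in>pverts G. of_bool (e i \<rightarrow>\<^bsub>G\<^esub> y) * f y)"
      by (rule sum.reindex_bij_betw[OF bij])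
    finally show ?thesis .
  qed
  have "z \<bullet> (A *\<^sub>v z) = (\<Sum>i<n. z $ i * (A *\<^sub>v z) $ i)"
    using A by (simp add: scalar_prod_def lessThan_atLeast0 del: index_mult_mat_vec)
  also have "\<dots> = (\<Sum>i<n. f (e i) * (\<Sum>y\<in>pverts G. of_bool (e i \<rightarrow>\<^bsub>G\<^esub> y) * f y))"
    by (intro sum.cong refl, subst Az) (simp_all add: z_def)
  also have "\<dots> = (\<Sum>x\<in>pverts G. f x * (\<Sum>y\<in>pverts G. of_bool (x \<rightarrow>\<^bsub>G\<^esub> y) * f y))"
    by (rule sum.reindex_bij_betw[OF bij])
  finally have zAz: "z \<bullet> (A *\<^sub>v z)
      = (\<Sum>x\<in>pverts G. f x * (\<Sum>y\<in>pverts G. of_bool (x \<rightarrow>\<^bsub>G\<^esub> y) * f y))" .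
  have "smallest_eigenvalue G * (z \<bullet> z) \<le> \<mu> * (z \<bullet> z)"
    using le by (intro mult_right_mono scalar_prod_self_nonneg)
  then show ?thesis using \<mu>(2)[OF z] zz zAz by simp
qed

lemma out_degree_eq_card_neighbours:
  assumes "pair_graph G"
  shows "out_degree G x = card {y \<in> pverts G. x \<rightarrow>\<^bsub>G\<^esub> y}"
proof -
  interpret pair_graph G by fact
  have "out_arcs G x = Pair x ` {y \<in> pverts G. x \<rightarrow>\<^bsub>G\<^esub> y}"
    using in_arcsD1 in_arcsD2 by (auto simp: out_arcs_def)
  then show ?thesis unfolding out_degree_def by (simp add: card_image inj_on_def)
qed

lemma regular_graph_row_sum:
  assumes "regular_graph G k" "x \<in> pverts G"
  shows "(\<Sum>y\<in>pverts G. of_bool (x \<rightarrow>\<^bsub>G\<^esub> y)) = real k"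
proof -
  interpret pair_graph G using assms by (simp add: regular_graph_def)
  have "(\<Sum>y\<in>pverts G. of_bool (x \<rightarrow>\<^bsub>G\<^esub> y)) = real (card {y \<in> pverts G. x \<rightarrow>\<^bsub>G\<^esub> y})"
    by (simp add: of_bool_def sum.If_cases Int_def)
  then show ?thesis
    using assms out_degree_eq_card_neighbours[of G x] by (simp add: regular_graph_def)
qed

lemma complement_arc_iff:
  assumes "x \<in> pverts G" "y \<in> pverts G"
  shows "x \<rightarrow>\<^bsub>complement_graph G\<^esub> y \<longleftrightarrow> x \<noteq> y \<and> \<not> x \<rightarrow>\<^bsub>G\<^esub> y"
  using assms by (simp add: complement_graph_def)

lemma regular_graph_complement:
  assumes "regular_graph G k"
  shows "regular_graph (complement_graph G) (card (pverts G) - 1 - k)"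
proof -
  interpret pair_graph G using assms by (simp add: regular_graph_def)
  have C: "pair_graph (complement_graph G)" by (rule pair_graph_complement) unfold_locales
  have "out_degree (complement_graph G) x = card (pverts G) - 1 - k" if x: "x \<in> pverts G" for x
  proof -
    have "{y \<in> pverts G. x \<rightarrow>\<^bsub>complement_graph G\<^esub> y} = (pverts G - {x}) - {y \<in> pverts G. x \<rightarrow>\<^bsub>G\<^esub> y}"
      using x by (auto simp: complement_graph_def)
    moreover have "{y \<in> pverts G. x \<rightarrow>\<^bsub>G\<^esub> y} \<subseteq> pverts G - {x}"
      using pair_no_loops by fastforce
    moreover have "card {y \<in> pverts G. x \<rightarrow>\<^bsub>G\<^esub> y} = k"
      using assms x out_degree_eq_card_neighbours[of G x] by (simp add: regular_graph_def)
    ultimately show ?thesis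
      using x out_degree_eq_card_neighbours[OF C, of x]
      by (simp add: complement_graph_def card_Diff_subset)
  qed
  then show ?thesis using C by (simp add: regular_graph_def complement_graph_def)
qed

text \<open>Nonemptiness makes the degree unique: an empty graph is regular of every degree.\<close>

lemma valency_eq:
  assumes "regular_graph G k" "pverts G \<noteq> {}"
  shows "valency G = k"
  unfolding valency_def using assms by (intro the_equality) (auto simp: regular_graph_def)

text \<open>For \<open>f\<close> orthogonal to the constants, the quadratic form of the complement is minus that of
  \<open>G\<close> minus the square norm. The general case follows by projecting \<open>f\<close>.\<close>

lemma complement_rayleigh:
  fixes f :: "'a \<Rightarrow> real"
  assumes G: "regular_graph G k" and ne: "pverts G \<noteq> {}"
  defines "v \<equiv> real (card (pverts G))" and "S \<equiv> (\<Sum>x\<in>pverts G. f x)"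
  shows "(\<Sum>x\<in>pverts G. f x * (\<Sum>y\<in>pverts G. of_bool (x \<rightarrow>\<^bsub>G\<^esub> y) * f y)) - real k * S^2 / v
    \<le> (- 1 - smallest_eigenvalue (complement_graph G)) * ((\<Sum>x\<in>pverts G. (f x)^2) - S^2 / v)"
proof -
  interpret pair_graph G using G by (simp add: regular_graph_def)
  let ?V = "pverts G"
  let ?Af = "\<lambda>x. \<Sum>y\<in>?V. of_bool (x \<rightarrow>\<^bsub>G\<^esub> y) * f y"
  have v: "v > 0" using ne by (simp add: v_def card_gt_0_iff)
  \<comment> \<open>The mean of \<open>f\<close>; subtracting it projects \<open>f\<close> onto the
    complement of the constants.\<close>
  define c where "c = S / v"
  define g where "g = (\<lambda>x. f x - c)"
  have g0: "(\<Sum>x\<in>?V. g x) = 0"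
    using v by (simp add: g_def sum_subtractf c_def v_def S_def)
  have g2: "(\<Sum>x\<in>?V. (g x)^2) = (\<Sum>x\<in>?V. (f x)^2) - S^2 / v"
  proof -
    have "(\<Sum>x\<in>?V. (g x)^2) = (\<Sum>x\<in>?V. (f x)^2 - 2 * c * f x + c^2)"
      by (simp add: g_def power2_eq_square algebra_simps)
    also have "\<dots> = (\<Sum>x\<in>?V. (f x)^2) - 2 * c * S + v * c^2"
      by (simp add: sum.distrib sum_subtractf S_def v_def flip: sum_distrib_left)
    finally show ?thesis using v by (simp add: c_def field_simps power2_eq_square)
  qed
  have Ag: "(\<Sum>y\<in>?V. of_bool (x \<rightarrow>\<^bsub>G\<^esub> y) * g y) = ?Af x - c * real k" if "x \<in> ?V" for x
    using regular_graph_row_sum[OF G that]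
    by (simp add: g_def right_diff_distrib sum_subtractf flip: sum_distrib_right)
  \<comment> \<open>By symmetry the column sums of the adjacency matrix equal \<open>k\<close> as
    well.\<close>
  have sumAf: "(\<Sum>x\<in>?V. ?Af x) = real k * S"
  proof -
    have "(\<Sum>x\<in>?V. ?Af x) = (\<Sum>y\<in>?V. (\<Sum>x\<in>?V. of_bool (y \<rightarrow>\<^bsub>G\<^esub> x)) * f y)"
      unfolding sum_distrib_right
      by (subst sum.swap) (auto intro!: sum.cong simp: of_bool_def intro: arcs_symmetric)
    also have "\<dots> = (\<Sum>y\<in>?V. real k * f y)"
      by (intro sum.cong refl) (simp only: regular_graph_row_sum[OF G])
    finally show ?thesis by (simp add: S_def sum_distrib_left)
  qed
  have gAg: "(\<Sum>x\<in>?V. g x * (\<Sum>y\<in>?V. of_bool (x \<rightarrow>\<^bsub>G\<^esub> y) * g y))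
      = (\<Sum>x\<in>?V. f x * ?Af x) - real k * S^2 / v"
  proof -
    have "(\<Sum>x\<in>?V. g x * (\<Sum>y\<in>?V. of_bool (x \<rightarrow>\<^bsub>G\<^esub> y) * g y))
        = (\<Sum>x\<in>?V. g x * (?Af x - c * real k))"
      by (intro sum.cong refl) (simp only: Ag)
    also have "\<dots> = (\<Sum>x\<in>?V. f x * ?Af x - c * ?Af x) - (\<Sum>x\<in>?V. g x) * (c * real k)"
      by (simp only: sum_distrib_right flip: sum_subtractf) (simp add: g_def algebra_simps)
    also have "\<dots> = (\<Sum>x\<in>?V. f x * ?Af x) - c * (real k * S)"
      by (simp only: g0 sum_subtractf sumAf mult_zero_left diff_zero flip: sum_distrib_left)
    finally show ?thesis by (simp add: c_def power2_eq_square)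
  qed
  \<comment> \<open>The adjacency matrix of the complement is \<open>J - I - A\<close>, and the
    all-ones matrix \<open>J\<close> annihilates \<open>g\<close>, whose sum is zero.\<close>
  have compl: "(\<Sum>y\<in>?V. of_bool (x \<rightarrow>\<^bsub>complement_graph G\<^esub> y) * g y)
      = - g x - (\<Sum>y\<in>?V. of_bool (x \<rightarrow>\<^bsub>G\<^esub> y) * g y)" if x: "x \<in> ?V" for x
  proof -
    have "\<not> x \<rightarrow>\<^bsub>G\<^esub> x" using pair_no_loops by fastforce
    then have "(\<Sum>y\<in>?V. of_bool (x \<rightarrow>\<^bsub>complement_graph G\<^esub> y) * g y)
        = (\<Sum>y\<in>?V. g y - (if x = y then g y else 0) - of_bool (x \<rightarrow>\<^bsub>G\<^esub> y) * g y)"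
      by (intro sum.cong refl) (auto simp: complement_arc_iff[OF x] simp del: with_proj_simps)
    then show ?thesis using x by (simp add: sum_subtractf g0)
  qed
  have "smallest_eigenvalue (complement_graph G) * (\<Sum>x\<in>?V. (g x)^2)
      \<le> (\<Sum>x\<in>?V. g x * (\<Sum>y\<in>?V. of_bool (x \<rightarrow>\<^bsub>complement_graph G\<^esub> y) * g y))"
    using smallest_eigenvalue_rayleigh[of "complement_graph G" g] ne G pair_graph_complement[of G]
    by (simp add: regular_graph_def complement_graph_def)
  also have "\<dots> = (\<Sum>x\<in>?V. - ((g x)^2) - g x * (\<Sum>y\<in>?V. of_bool (x \<rightarrow>\<^bsub>G\<^esub> y) * g y))"
    by (intro sum.cong refl, simp only: compl) (simp add: algebra_simps power2_eq_square)
  also have "\<dots> = - (\<Sum>x\<in>?V. (g x)^2) - (\<Sum>x\<in>?V. g x * (\<Sum>y\<in>?V. of_bool (x \<rightarrow>\<^bsub>G\<^esub> y) * g y))"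
    by (simp only: sum_subtractf sum_negf)
  finally have "(\<Sum>x\<in>?V. g x * (\<Sum>y\<in>?V. of_bool (x \<rightarrow>\<^bsub>G\<^esub> y) * g y))
      \<le> (- 1 - smallest_eigenvalue (complement_graph G)) * (\<Sum>x\<in>?V. (g x)^2)"
    by (simp only: left_diff_distrib)
  then show ?thesis unfolding g2 gAg .
qed

text \<open>The test vector is the indicator of \<open>a\<close> plus \<open>s\<close> times that of
  \<open>b\<close>. One statement covers both uses: \<open>s = 1\<close> on an edge, and
  \<open>s = - 1\<close> on a non-adjacent pair, where the vector already has sum zero.\<close>

lemma complement_rayleigh_pair:
  assumes G: "regular_graph G k" and ab: "a \<in> pverts G" "b \<in> pverts G" "a \<noteq> b"
  defines "v \<equiv> real (card (pverts G))"
  shows "2 * s * of_bool (a \<rightarrow>\<^bsub>G\<^esub> b) - real k * (1 + s)^2 / v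
    \<le> (- 1 - smallest_eigenvalue (complement_graph G)) * (1 + s^2 - (1 + s)^2 / v)"
proof -
  interpret pair_graph G using G by (simp add: regular_graph_def)
  let ?V = "pverts G"
  define f where "f = (\<lambda>x. of_bool (x = a) + s * of_bool (x = b) :: real)"
  \<comment> \<open>Pairing with \<open>f\<close> evaluates \<open>h\<close> at two points. The sum,
    the square norm and the action of the adjacency matrix are all instances.\<close>
  have weight: "(\<Sum>x\<in>?V. f x * h x) = h a + s * h b" for h
  proof -
    have "(\<Sum>x\<in>?V. f x * h x) = (\<Sum>x\<in>?V. (if x = a then h x else 0) + s * (if x = b then h x else 0))"
      by (intro sum.cong) (auto simp: f_def algebra_simps)
    then show ?thesis using ab(1,2) by (simp add: sum.distrib flip: sum_distrib_left)
  qed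
  have S: "(\<Sum>x\<in>?V. f x) = 1 + s" using weight[of "\<lambda>_. 1"] by simp
  have f2: "(\<Sum>x\<in>?V. (f x)^2) = 1 + s^2"
    using weight[of f] ab(3) by (simp add: f_def power2_eq_square)
  have Af: "(\<Sum>y\<in>?V. of_bool (x \<rightarrow>\<^bsub>G\<^esub> y) * f y) = of_bool (x \<rightarrow>\<^bsub>G\<^esub> a) + s * of_bool (x \<rightarrow>\<^bsub>G\<^esub> b)" for x
    using weight[of "\<lambda>y. of_bool (x \<rightarrow>\<^bsub>G\<^esub> y)"] by (simp only: mult.commute)
  have "\<not> a \<rightarrow>\<^bsub>G\<^esub> a" "\<not> b \<rightarrow>\<^bsub>G\<^esub> b" using pair_no_loops by fastforce+
  moreover have "b \<rightarrow>\<^bsub>G\<^esub> a \<longleftrightarrow> a \<rightarrow>\<^bsub>G\<^esub> b" by (auto intro: arcs_symmetric)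
  ultimately have fAf: "(\<Sum>x\<in>?V. f x * (\<Sum>y\<in>?V. of_bool (x \<rightarrow>\<^bsub>G\<^esub> y) * f y)) = 2 * s * of_bool (a \<rightarrow>\<^bsub>G\<^esub> b)"
    unfolding Af weight by simp
  show ?thesis
    using complement_rayleigh[OF G, of f] ab(1) unfolding S f2 fAf v_def by blast
qed

text \<open>The test vector is the indicator of the neighbourhood of \<open>p\<close> minus
  \<open>t\<close> times that of \<open>p\<close>. Arcs among the neighbours contribute
  \<open>k * l\<close> to its quadratic form, since each neighbour shares \<open>l\<close>
  neighbours with \<open>p\<close>; arcs at \<open>p\<close> contribute
  \<open>- 2 * t * k\<close>.\<close>

lemma complement_rayleigh_star:
  assumes er: "edge_regular G v k l" and p: "p \<in> pverts G"
  shows "real k * real l - 2 * t * real k - real k * (real k - t)^2 / real v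
    \<le> (- 1 - smallest_eigenvalue (complement_graph G)) * (real k + t^2 - (real k - t)^2 / real v)"
proof -
  have G: "regular_graph G k" using er by (simp add: edge_regular_def)
  interpret pair_graph G using G by (simp add: regular_graph_def)
  let ?V = "pverts G"
  have loop: "\<not> p \<rightarrow>\<^bsub>G\<^esub> p" using pair_no_loops by fastforce
  define f where "f = (\<lambda>x. of_bool (p \<rightarrow>\<^bsub>G\<^esub> x) - t * of_bool (x = p) :: real)"
  have weight: "(\<Sum>x\<in>?V. f x * h x) = (\<Sum>x\<in>?V. of_bool (p \<rightarrow>\<^bsub>G\<^esub> x) * h x) - t * h p" for h
  proof -
    have "(\<Sum>x\<in>?V. f x * h x)
        = (\<Sum>x\<in>?V. of_bool (p \<rightarrow>\<^bsub>G\<^esub> x) * h x - t * (if x = p then h x else 0))"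
      by (intro sum.cong) (auto simp: f_def algebra_simps)
    then show ?thesis using p by (simp add: sum_subtractf flip: sum_distrib_left)
  qed
  have deg: "(\<Sum>x\<in>?V. of_bool (p \<rightarrow>\<^bsub>G\<^esub> x) * c) = real k * c" for c
    using regular_graph_row_sum[OF G p] by (simp flip: sum_distrib_right)
  have "(\<Sum>x\<in>?V. f x) = real k - t" using weight[of "\<lambda>_. 1"] deg[of 1] by simp
  moreover have "(\<Sum>x\<in>?V. (f x)^2) = real k + t^2"
  proof -
    have "(\<Sum>x\<in>?V. of_bool (p \<rightarrow>\<^bsub>G\<^esub> x) * f x) = (\<Sum>x\<in>?V. of_bool (p \<rightarrow>\<^bsub>G\<^esub> x) * 1)"
      using loop by (intro sum.cong) (auto simp: f_def simp del: with_proj_simps)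
    then show ?thesis
      using weight[of f] deg[of 1] loop by (simp add: f_def power2_eq_square)
  qed
  moreover have "(\<Sum>x\<in>?V. f x * (\<Sum>y\<in>?V. of_bool (x \<rightarrow>\<^bsub>G\<^esub> y) * f y)) = real k * real l - 2 * t * real k"
  proof -
    have Af: "(\<Sum>y\<in>?V. of_bool (x \<rightarrow>\<^bsub>G\<^esub> y) * f y)
        = (\<Sum>y\<in>?V. of_bool (p \<rightarrow>\<^bsub>G\<^esub> y \<and> x \<rightarrow>\<^bsub>G\<^esub> y)) - t * of_bool (x \<rightarrow>\<^bsub>G\<^esub> p)" for x
      using weight[of "\<lambda>y. of_bool (x \<rightarrow>\<^bsub>G\<^esub> y)"] by (simp only: mult.commute of_bool_conj)
    have common: "(\<Sum>y\<in>?V. of_bool (p \<rightarrow>\<^bsub>G\<^esub> y \<and> x \<rightarrow>\<^bsub>G\<^esub> y)) = real l" if "p \<rightarrow>\<^bsub>G\<^esub> x" for x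
      using er that by (simp add: edge_regular_def of_bool_def sum.If_cases Int_def)
    \<comment> \<open>A neighbour \<open>x\<close> of \<open>p\<close> sees weight 1 at each of the
      \<open>l\<close> common neighbours and weight \<open>- t\<close> at \<open>p\<close>
      itself.\<close>
    have "(\<Sum>x\<in>?V. of_bool (p \<rightarrow>\<^bsub>G\<^esub> x) * (\<Sum>y\<in>?V. of_bool (x \<rightarrow>\<^bsub>G\<^esub> y) * f y))
        = (\<Sum>x\<in>?V. of_bool (p \<rightarrow>\<^bsub>G\<^esub> x) * (real l - t))"
    proof (intro sum.cong refl)
      fix x
      show "of_bool (p \<rightarrow>\<^bsub>G\<^esub> x) * (\<Sum>y\<in>?V. of_bool (x \<rightarrow>\<^bsub>G\<^esub> y) * f y)
          = of_bool (p \<rightarrow>\<^bsub>G\<^esub> x) * (real l - t)"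
      proof (cases "p \<rightarrow>\<^bsub>G\<^esub> x")
        case True
        then have "x \<rightarrow>\<^bsub>G\<^esub> p" by (auto intro: arcs_symmetric)
        then show ?thesis unfolding Af common[OF True] by simp
      next
        case False
        then show ?thesis by simp
      qed
    qed
    moreover have "(\<Sum>y\<in>?V. of_bool (p \<rightarrow>\<^bsub>G\<^esub> y) * f y) = real k"
      unfolding Af using regular_graph_row_sum[OF G p] loop by simp
    ultimately show ?thesis
      unfolding weight by (simp only: deg) (simp add: algebra_simps)
  qed
  ultimately show ?thesis
    using complement_rayleigh[OF G, of f] p er
    by (auto simp: edge_regular_def)
qed

subsection \<open>The clique adjacency bound\<close>

text \<open>The hypothesis \<open>F\<close> says that the discriminant of the quadratic in \<open>x\<close> exceeds the square of its
  leading coefficient.\<close>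

lemma clique_adjacency_poly_neg_at_int:
  fixes y :: real
  assumes yv: "y < real v" and y0: "y > 0"
    and F: "(real v - y) * ((real k - y + 1) + (y - 1) * (real l - y + 2)) < y * (real k - y + 1)^2"
  shows "\<exists>m::int. clique_adjacency_poly v k l (of_int m) y < 0"
proof -
  define a where "a = real v - y"
  define B where "B = y * (real k - y + 1)"
  define c where "c = y * (y - 1) * (real l - y + 2)"
  \<comment> \<open>The parabola in \<open>x\<close> has its vertex at \<open>B / a - 1/2\<close>,
    so the floor of \<open>B / a\<close> is within 1/2 of the vertex; \<open>e\<close> is the
    fractional part.\<close>
  define e where "e = B / a - of_int \<lfloor>B / a\<rfloor>"
  have a: "a > 0" using yv by (simp add: a_def)
  have e: "0 \<le> e" "e < 1" unfolding e_def by linarith+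
  have "a * B + a * c < B^2"
    using mult_strict_left_mono[OF F y0]
    by (simp add: a_def B_def c_def algebra_simps power2_eq_square)
  then have neg: "- (B^2 - a * B - a * c) / a < 0"
    using a by (simp add: divide_neg_pos)
  have m: "of_int \<lfloor>B / a\<rfloor> = B / a - e" by (simp add: e_def)
  have "clique_adjacency_poly v k l x y = a * x * (x + 1) - 2 * B * x + c" for x
    by (simp add: clique_adjacency_poly_def a_def B_def c_def)
  then have "clique_adjacency_poly v k l (of_int \<lfloor>B / a\<rfloor>) y
      = a * (B / a - e) * (B / a - e + 1) - 2 * B * (B / a - e) + c"
    by (simp only: m)
  \<comment> \<open>The first term is the common value of the parabola at \<open>B / a\<close> and
    \<open>B / a - 1\<close>; the second is the further drop between these points.\<close>
  also have "\<dots> = - (B^2 - a * B - a * c) / a - a * (e * (1 - e))"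
    using a by (simp add: field_simps power2_eq_square)
  also have "\<dots> < 0"
  proof -
    have "0 \<le> a * (e * (1 - e))" using a e by simp
    then show ?thesis using neg by linarith
  qed
  finally show ?thesis by blast
qed

text \<open>At \<open>y = v\<close> the quadratic term vanishes and the slope
  \<open>2 * v * (v - k - 1)\<close> is positive, so every sufficiently negative integer works;
  \<open>- (v * l) - 1\<close> is far enough.\<close>

lemma clique_adjacency_poly_neg_at_order:
  assumes "k + 2 \<le> v"
  shows "\<exists>m::int. clique_adjacency_poly v k l (of_int m) (real v) < 0"
proof
  define w where "w = real v * real l"
  define p where "p = (w + 1) * (real v - real k - 1)"
  define q where "q = (real v - 1) * (real l + 2 - real v)"
  have w: "w \<ge> 0" by (simp add: w_def)
  have "w + 1 \<le> p"
    unfolding p_def using assms w mult_left_mono[of 1 "real v - real k - 1" "w + 1"] by simp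
  moreover have "q \<le> w"
    unfolding q_def w_def using assms by (intro order.trans[OF mult_left_mono mult_right_mono]) auto
  ultimately have "q - 2 * p < 0" using w by linarith
  moreover have "clique_adjacency_poly v k l (of_int (- (int v * int l) - 1)) (real v)
      = real v * (q - 2 * p)"
    by (simp add: clique_adjacency_poly_def w_def p_def q_def algebra_simps)
  ultimately show "clique_adjacency_poly v k l (of_int (- (int v * int l) - 1)) (real v) < 0"
    using assms by (simp add: mult_pos_neg)
qed

text \<open>This isolates the real-number argument: \<theta> stands for
  \<open>- 1 - \<sigma>\<close>, and \<open>edge\<close> and \<open>star\<close> are the
  inequalities supplied by the test vectors.\<close>

lemma CAB_le_of_spectral_bounds:
  fixes \<theta> :: real
  assumes \<theta>: "\<theta> \<ge> 0" and k: "k > 0" and kv: "k + 2 \<le> v"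
    and edge: "2 - 4 * real k / real v \<le> \<theta> * (2 - 4 / real v)"
    and star: "\<And>t::real. real k * real l - 2 * t * real k - real k * (real k - t)^2 / real v
       \<le> \<theta> * (real k + t^2 - (real k - t)^2 / real v)"
  shows "real (CAB v k l) \<le> real v * (1 + \<theta>) / (real v - real k + \<theta>)" (is "_ \<le> ?h")
proof -
  define h where "h = ?h"
  \<comment> \<open>The definition of \<open>CAB\<close> evaluates the polynomial at the candidate
    plus one. The candidate is the floor of \<open>h\<close>, so \<open>y\<close> is the first
    integer strictly above \<open>h\<close>.\<close>
  define y where "y = real (nat \<lfloor>h\<rfloor>) + 1"
  have v: "real v > 0" and d: "real v - real k + \<theta> > 0" using kv \<theta> by auto
  have "(2 - 4 * real k / real v) * real v = 2 * real v - 4 * real k"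
    "\<theta> * (2 - 4 / real v) * real v = \<theta> * (2 * real v - 4)"
    using v by (simp_all add: field_simps)
  \<comment> \<open>This is \<open>edge\<close> multiplied by \<open>v\<close>, rearranged into
    \<open>h \<ge> 2\<close>; it makes the floor of \<open>h\<close> an admissible candidate in
    \<open>CAB\<close>.\<close>
  then have "2 * (real v - real k + \<theta>) \<le> real v * (1 + \<theta>)"
    using mult_right_mono[OF edge, of "real v"] by (simp add: algebra_simps)
  then have h2: "2 \<le> h" using d by (simp add: h_def pos_le_divide_eq)
  have "real v * (1 + \<theta>) < real v * (real v - real k + \<theta>)"
    using kv by (intro mult_strict_left_mono) auto
  then have hv: "h < real v" using d by (simp add: h_def pos_divide_less_eq)
  have "2 \<le> \<lfloor>h\<rfloor>" using h2 by (simp add: le_floor_iff)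
  then have nat: "real (nat \<lfloor>h\<rfloor>) = of_int \<lfloor>h\<rfloor>" "2 \<le> nat \<lfloor>h\<rfloor>" by linarith+
  have y3: "3 \<le> y" unfolding y_def using nat(2) by linarith
  have hy: "h < y" unfolding y_def nat(1) by linarith
  have fl: "real (nat \<lfloor>h\<rfloor>) \<le> h" unfolding nat(1) by linarith
  have "real (nat \<lfloor>h\<rfloor>) < real v" using fl hv by linarith
  then have "nat \<lfloor>h\<rfloor> < v" by simp
  then have yv: "y \<le> real v" unfolding y_def by linarith
  have ex: "\<exists>m::int. clique_adjacency_poly v k l (of_int m) y < 0"
  proof (cases "y = real v")
    case True
    then show ?thesis using clique_adjacency_poly_neg_at_order[OF kv] by simp
  next
    case False
    with yv have yv: "y < real v" by simp
    define s where "s = y - 1"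
    \<comment> \<open>\<open>y > h\<close> reads \<open>\<theta> * (v - y) < N\<close>, and
      \<open>star\<close> at \<open>t = - k / s\<close>, multiplied by \<open>v * s^2\<close>, reads
      \<open>R \<le> \<theta> * P\<close>. Eliminating \<theta> gives
      \<open>R * (v - y) < N * P\<close>. This \<open>t\<close> makes \<open>star\<close> tightest
      at the value of \<theta> for which \<open>h\<close> would equal \<open>y\<close>.\<close>
    define N where "N = y * (real v - real k) - real v"
    define P where "P = real k * ((real v - 1) * real k - 2 * real k * s + (real v - real k) * s^2)"
    define R where "R = real v * real k * real l * s^2 + 2 * real v * (real k)^2 * s - (real k)^3 * y^2"
    have s: "s > 0" using y3 by (simp add: s_def)
    have "real v * (1 + \<theta>) < y * (real v - real k + \<theta>)"
      using hy d by (simp add: h_def pos_divide_less_eq)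
    then have \<theta>N: "\<theta> * (real v - y) < N" by (simp add: N_def algebra_simps)
    have kt: "real k + real k / s = real k * y / s" using s by (simp add: s_def field_simps)
    have "(real v * s^2) * (real k * real l - 2 * (- real k / s) * real k - real k * (real k * y / s)^2 / real v)
       \<le> (real v * s^2) * (\<theta> * (real k + (- real k / s)^2 - (real k * y / s)^2 / real v))"
      using star[of "- real k / s"] s v by (intro mult_left_mono) (simp_all add: kt)
    moreover have "(real v * s^2) * (real k * real l - 2 * (- real k / s) * real k - real k * (real k * y / s)^2 / real v) = R"
      using s v by (simp add: R_def field_simps power2_eq_square power3_eq_cube)
    moreover have "(real v * s^2) * (\<theta> * (real k + (- real k / s)^2 - (real k * y / s)^2 / real v))
       = \<theta> * (real v * s^2 * real k + real v * (real k)^2 - (real k)^2 * y^2)"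
      using s v by (simp add: field_simps power2_eq_square)
    moreover have "real v * s^2 * real k + real v * (real k)^2 - (real k)^2 * y^2 = P"
    proof -
      have y: "y = s + 1" by (simp add: s_def)
      show ?thesis unfolding P_def y by (simp add: algebra_simps power2_eq_square)
    qed
    ultimately have R: "R \<le> \<theta> * P" by (simp only:)
    \<comment> \<open>Completing the square shows \<open>P > 0\<close>, which keeps the elimination
      of \<theta> strict. Up to the factor \<open>v * s^2\<close>, \<open>P\<close> is the square
      norm of the projected test vector.\<close>
    have "(real v - 1) * ((real v - 1) * real k - 2 * real k * s + (real v - real k) * s^2)
        = real k * ((real v - 1) - s)^2 + real v * (real v - 1 - real k) * s^2"
      by (simp add: algebra_simps power2_eq_square)
    also have "\<dots> > 0"
      using s v kv by (intro add_nonneg_pos mult_pos_pos) auto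
    finally have "(real v - 1) * real k - 2 * real k * s + (real v - real k) * s^2 > 0"
      using kv by (simp add: zero_less_mult_iff)
    then have P: "P > 0" using k by (simp add: P_def)
    have "R * (real v - y) \<le> (\<theta> * (real v - y)) * P"
      using mult_right_mono[OF R, of "real v - y"] yv by (simp add: mult.assoc mult.commute mult.left_commute)
    also have "\<dots> < N * P" using \<theta>N P by (rule mult_strict_right_mono)
    finally have "0 < N * P - R * (real v - y)" by simp
    \<comment> \<open>The gap left by the elimination is a positive multiple of the discriminant gap
      that the integer lemma requires.\<close>
    also have "\<dots> = (real v * real k * s) * (y * (real k - y + 1)^2
        - (real v - y) * ((real k - y + 1) + (y - 1) * (real l - y + 2)))"
      unfolding N_def P_def R_def s_def
      by (simp add: algebra_simps power2_eq_square power3_eq_cube)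
    finally have "0 < (real v * real k * s) * (y * (real k - y + 1)^2
        - (real v - y) * ((real k - y + 1) + (y - 1) * (real l - y + 2)))" .
    moreover have "real v * real k * s > 0" using v k s by simp
    ultimately have "(real v - y) * ((real k - y + 1) + (y - 1) * (real l - y + 2)) < y * (real k - y + 1)^2"
      by (simp add: zero_less_mult_iff)
    then show ?thesis using yv y3 by (intro clique_adjacency_poly_neg_at_int) auto
  qed
  have "CAB v k l \<le> nat \<lfloor>h\<rfloor>"
    unfolding CAB_def using nat(2) ex by (intro Least_le) (simp add: y_def)
  then show ?thesis using fl unfolding h_def by linarith
qed

theorem theorem7p3:
  fixes \<Gamma> :: "'a pair_pre_digraph" and v k l :: nat
  assumes "edge_regular \<Gamma> v k l"
    and "\<not> complete_digraph v \<Gamma>"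
  shows "real (CAB v k l) \<le> Haem_ge (complement_graph \<Gamma>) 0 \<and>
    Haem_ge (complement_graph \<Gamma>) 0 =
      real v * (- smallest_eigenvalue (complement_graph \<Gamma>) /
        ((real v - real k - 1) - smallest_eigenvalue (complement_graph \<Gamma>)))"
proof -
  have G: "regular_graph \<Gamma> k" and v: "card (pverts \<Gamma>) = v" and arcs: "parcs \<Gamma> \<noteq> {}"
    using assms(1) by (simp_all add: edge_regular_def)
  interpret pair_graph \<Gamma> using G by (simp add: regular_graph_def)
  define \<theta> where "\<theta> = - 1 - smallest_eigenvalue (complement_graph \<Gamma>)"
  obtain a b where "(a, b) \<in> parcs \<Gamma>" using arcs by fast
  then have ab: "a \<in> pverts \<Gamma>" "b \<in> pverts \<Gamma>" "a \<rightarrow>\<^bsub>\<Gamma>\<^esub> b" "a \<noteq> b"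
    using in_arcsD1 in_arcsD2 pair_no_loops[of "(a, b)"] by auto
  have ne: "pverts \<Gamma> \<noteq> {}" using ab by blast
  have "parcs \<Gamma> \<subseteq> {(x, y). (x, y) \<in> pverts \<Gamma> \<times> pverts \<Gamma> \<and> x \<noteq> y}"
    using arc_fst_in_verts arc_snd_in_verts pair_no_loops by fastforce
  moreover have "parcs \<Gamma> \<noteq> {(x, y). (x, y) \<in> pverts \<Gamma> \<times> pverts \<Gamma> \<and> x \<noteq> y}"
    using assms(2) v unfolding complete_digraph_pair_def by simp
  ultimately obtain c d where cd: "c \<in> pverts \<Gamma>" "d \<in> pverts \<Gamma>" "c \<noteq> d" "\<not> c \<rightarrow>\<^bsub>\<Gamma>\<^esub> d"
    by auto
  let ?N = "\<lambda>x. {y \<in> pverts \<Gamma>. x \<rightarrow>\<^bsub>\<Gamma>\<^esub> y}"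
  have deg: "card (?N x) = k" if "x \<in> pverts \<Gamma>" for x
    using that G out_degree_eq_card_neighbours[of \<Gamma> x] by (simp add: regular_graph_def)
  have k: "k > 0" using deg[OF ab(1)] ab by (auto simp: card_gt_0_iff)
  \<comment> \<open>The vertex \<open>c\<close>, its \<open>k\<close> neighbours and the
    non-neighbour \<open>d\<close> are all distinct, hence \<open>k + 2 \<le> v\<close>.\<close>
  have "card (insert c (insert d (?N c))) \<le> v"
    unfolding v[symmetric] using cd by (intro card_mono) auto
  moreover have "\<not> c \<rightarrow>\<^bsub>\<Gamma>\<^esub> c" using pair_no_loops by fastforce
  ultimately have kv: "k + 2 \<le> v"
    using cd deg[OF cd(1)] by simp
  have "\<theta> \<ge> 0"
    using complement_rayleigh_pair[OF G cd(1-3), of "- 1"] cd(4) by (simp add: \<theta>_def)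
  moreover have "2 - 4 * real k / real v \<le> \<theta> * (2 - 4 / real v)"
    using complement_rayleigh_pair[OF G ab(1,2,4), of 1] ab(3) by (simp add: \<theta>_def v mult.commute)
  ultimately have "real (CAB v k l) \<le> real v * (1 + \<theta>) / (real v - real k + \<theta>)"
    using k kv complement_rayleigh_star[OF assms(1) ab(1)]
    unfolding \<theta>_def by (intro CAB_le_of_spectral_bounds) auto
  moreover have "valency (complement_graph \<Gamma>) = v - 1 - k"
    using regular_graph_complement[OF G] ne v by (intro valency_eq) (auto simp: complement_graph_def)
  moreover have "card (pverts (complement_graph \<Gamma>)) = v" using v by (simp add: complement_graph_def)
  ultimately show ?thesis
    \<comment> \<open>Here \<open>1 + \<theta>\<close> is \<open>- \<sigma>\<close> and
      \<open>v - k + \<theta>\<close> is \<open>(v - k - 1) - \<sigma>\<close>;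
      \<open>k + 2 \<le> v\<close> keeps the natural subtraction in the valency from
      truncating.\<close>
    using kv by (simp add: Haem_ge_def \<theta>_def of_nat_diff algebra_simps)
qed

end
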